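(* In the sequential collaborative-recommendation model described in the context, suppose that $\eta_n(\mathbf{X}^\star)\to\eta(\mathbf{X}^\star)$ in probability as $n\to\infty$, where $\eta_n$ is the cosine-type $k_n$-nearest neighbor regression estimate and $\eta(\mathbf{x}^\star)=\mathbb{E}[Y\mid \mathbf{X}^\star=\mathbf{x}^\star]$. Then $$\eta(\mathbf{X}^\star)=\|\mathbf{X}^\star\|\;\mathbb{E}\left[\frac{Y}{\|\mathbf{X}^\star\|}\;\Big|\;\frac{\mathbf{X}^\star}{\|\mathbf{X}^\star\|}\right]\quad\text{almost surely.}$$
   Context: Model. Fix an integer $d\ge 1$ and a real $s>1$. For a finite set $A$, $|A|$ is its cardinality; $\mathcal{P}^\star(A)$ is the set of nonempty subsets of $A$; $\|\cdot\|$ is the Euclidean norm on $\mathbb{R}^d$. - New user: $(\mathbf{X},Y)$ is a random pair in $[1,s]^d\times[1,s]$, $\mathbf{X}=(X_1,\dots,X_d)$, and $M$ is a random element of $\mathcal{P}^\star(\{1,\dots,d\})$. Define $\mathbf{X}^\star=(X_1^\star,\dots,X_d^\star)$ by $X_j^\star=X_j$ if $j\in M$ and $X_j^\star=0$ otherwise. - Database users: $(\mathbf{X}_1,Y_1),\dots,(\mathbf{X}_n,Y_n)$ are independent random pairs with the distribution of $(\mathbf{X},Y)$, $\mathbf{X}_i=(X_{i1},\dots,X_{id})$. - For each $i\ge1$, $(M_i^n)_{n\ge1}$ is a sequence of random elements of $\mathcal{P}^\star(\{1,\dots,d\})$ with $M_i^n\subset M_i^{n+1}$ for all $n$; its law does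 not depend on $i$ and is that of a generic sequence $(M^n)_{n\ge1}$, for which there is a positive random integer $n_0$ with $M^n=\{1,\dots,d\}$ for all $n\ge n_0$. $M$ has the same distribution as $M^1$. - The pairs $(\mathbf{X}_i,Y_i)$, $i=1,\dots,n$, the sequences $(M_1^n)_{n\ge1},(M_2^n)_{n\ge1},\dots$ and the random variable $M$ are mutually independent. - $(\mathcal{R}_n)_{n\ge1}$ is a sequence of random sets, $\mathcal{R}_n\in\mathcal{P}^\star(\{1,\dots,n\})$, with $\mathcal{R}_n$ independent of $M$ and of the sequences $(M_i^n)_{n\ge1}$, and $\mathcal{R}_n\subset\mathcal{R}_{n+1}$ for all $n\ge1$. Masked ratings. For $1\le i\le n$, $\mathbf{X}_i^{(n)}=(X_{i1}^{(n)},\dots,X_{id}^{(n)})$ with $X_{ij}^{(n)}=X_{ij}$ if $j\in M_i^{n+1-i}\cap M$ and $0$ otherwise. Similarity. For $\mathbf{x},\mathbf{x}'\in(\{0\}\cup[1,s])^d$, with $\mathcal{J}=\{j: x_j\ne0\text{ and }x_j'\neq0\}$, $$\bar S(\mathbf{x},\mathbf{x}')=\frac{\sum_{j\in\mathcal J}x_jx_j'}{\sqrt{\sum_{j\in\mathcal J}x_j^2}\sqrt{\sum_{j\in\mathcal J}x_j'^2}},$$ and $\bar S(\mathbf{x},\mathbf{x}')=0$ if $\mathcal{J}=\varnothing$. Put $S(\mathbf{x}^\star,\mathbf{X}_i^{(n)})=p_i^{(n)}\bar S(\mathbf{x}^\star,\mathbf{X}_i^{(n)})$ with $p_i^{(n)}=|M_i^{n+1-i}\cap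 M|/|M|$. Estimate. Let $k_n$ be integers with $1\le k_n\le n$. For $\mathbf{x}^\star\in(\{0\}\cup[1,s])^d\setminus\{\mathbf{0}\}$, $$\eta_n(\mathbf{x}^\star)=\|\mathbf{x}^\star\|\sum_{i\in\mathcal{R}_n}W_{ni}(\mathbf{x}^\star)\frac{Y_i}{\|\mathbf{X}_i^{(n)}\|},$$ where $W_{ni}(\mathbf{x}^\star)=1/k_n$ if $\mathbf{X}_i^{(n)}$ is among the $k_n$ most similar to $\mathbf{x}^\star$ (i.e. with the $k_n$ largest values of $S(\mathbf{x}^\star,\cdot)$) in $\{\mathbf{X}_i^{(n)}, i\in\mathcal{R}_n\}$, ties being broken by indices (the smaller index is declared closer), and $W_{ni}(\mathbf{x}^\star)=0$ otherwise. Conventions: if $|\mathcal{R}_n|<k_n$ all weights are $0$; if $\mathbf{X}_i^{(n)}=\mathbf{0}$ then $W_{ni}(\mathbf{x}^\star)=0$ and $0\times\infty=0$.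
   Formalization: It is additionally assumed that, given M, the new user's pair (X,Y) is independent of the whole database (all ratings, masks and sets R_n); without this the claim fails, e.g. for d=1, k_n=1, (X,Y)=(X_1,Y_1), Y=1, R_n={1,...,n} and X non-constant. *)

theory Defs
  imports "HOL-Probability.Probability"
begin

definition Pstar :: "'a set \<Rightarrow> 'a set set" where
  "Pstar A = Pow A - {{}}"

text \<open>The sigma-algebra on \<^term>\<open>space P\<close> generated by a random element \<open>Z\<close> with values in \<open>N\<close>.\<close>

definition gen_sets :: "'a measure \<Rightarrow> 'b measure \<Rightarrow> ('a \<Rightarrow> 'b) \<Rightarrow> 'a set set" where
  "gen_sets P N Z = sets (vimage_algebra (space P) Z N)"

text \<open>Time and user indices start at 1; values at index 0 are never used.
  Items are the elements of the finite type \<open>'d\<close>, so that \<open>d = CARD('d) \<ge> 1\<close>.\<close>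

abbreviation mask_space :: "'d::finite set measure" where
  "mask_space \<equiv> count_space (Pstar UNIV)"

abbreviation mask_seq_space :: "(nat \<Rightarrow> 'd::finite set) measure" where
  "mask_seq_space \<equiv> PiM {1..} (\<lambda>_. mask_space)"

definition mask_process :: "'a measure \<Rightarrow> (nat \<Rightarrow> 'a \<Rightarrow> 'd::finite set) \<Rightarrow> bool" where
  "mask_process P G \<longleftrightarrow>
     (\<forall>n\<ge>1. G n \<in> measurable P mask_space) \<and>
     (\<forall>n\<ge>1. \<forall>\<omega>\<in>space P. G n \<omega> \<subseteq> G (Suc n) \<omega>)"

text \<open>The part of the rating vector \<open>x\<close> visible through the mask \<open>A\<close>.\<close>

definition masked :: "'d set \<Rightarrow> real ^ 'd::finite \<Rightarrow> real ^ 'd" where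
  "masked A x = (\<chi> j. if j \<in> A then x $ j else 0)"

definition cos_sim :: "real ^ 'd::finite \<Rightarrow> real ^ 'd \<Rightarrow> real" where
  "cos_sim x x' =
     (let J = {j. x $ j \<noteq> 0 \<and> x' $ j \<noteq> 0} in
      if J = {} then 0
      else (\<Sum>j\<in>J. x $ j * x' $ j) /
             (sqrt (\<Sum>j\<in>J. (x $ j)\<^sup>2) * sqrt (\<Sum>j\<in>J. (x' $ j)\<^sup>2)))"

text \<open>\<open>knn_weight k R V S i\<close> is the weight of user \<open>i\<close> among the users in \<open>R\<close>, where \<open>V\<close> gives
  their rating vectors and \<open>S\<close> their similarities to the query point. User \<open>i\<close> is among the
  \<open>k\<close> most similar ones iff fewer than \<open>k\<close> users precede it in the order by decreasing
  similarity, ties being broken by smaller index.\<close>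

definition knn_weight ::
  "nat \<Rightarrow> nat set \<Rightarrow> (nat \<Rightarrow> real ^ 'd::finite) \<Rightarrow> (nat \<Rightarrow> real) \<Rightarrow> nat \<Rightarrow> real" where
  "knn_weight k R V S i =
     (if i \<in> R \<and> k \<le> card R \<and> V i \<noteq> 0 \<and>
         card {l \<in> R. S l > S i \<or> (S l = S i \<and> l < i)} < k
      then 1 / real k else 0)"

text \<open>\<open>M\<close>: mask of the new user; \<open>Xs i\<close>, \<open>Ys i\<close>: ratings of database user \<open>i\<close>;
  \<open>Ms i n\<close>: the mask \<open>M_i^n\<close>.\<close>

definition common_mask ::
  "('a \<Rightarrow> 'd::finite set) \<Rightarrow> (nat \<Rightarrow> nat \<Rightarrow> 'a \<Rightarrow> 'd set) \<Rightarrow> nat \<Rightarrow> nat \<Rightarrow> 'a \<Rightarrow> 'd set" where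
  "common_mask M Ms n i \<omega> = Ms i (n + 1 - i) \<omega> \<inter> M \<omega>"

definition masked_ratings ::
  "('a \<Rightarrow> 'd::finite set) \<Rightarrow> (nat \<Rightarrow> 'a \<Rightarrow> real ^ 'd) \<Rightarrow> (nat \<Rightarrow> nat \<Rightarrow> 'a \<Rightarrow> 'd set) \<Rightarrow>
     nat \<Rightarrow> nat \<Rightarrow> 'a \<Rightarrow> real ^ 'd" where
  "masked_ratings M Xs Ms n i \<omega> = masked (common_mask M Ms n i \<omega>) (Xs i \<omega>)"

definition similarity ::
  "('a \<Rightarrow> 'd::finite set) \<Rightarrow> (nat \<Rightarrow> 'a \<Rightarrow> real ^ 'd) \<Rightarrow> (nat \<Rightarrow> nat \<Rightarrow> 'a \<Rightarrow> 'd set) \<Rightarrow>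
     nat \<Rightarrow> real ^ 'd \<Rightarrow> nat \<Rightarrow> 'a \<Rightarrow> real" where
  "similarity M Xs Ms n x i \<omega> =
     real (card (common_mask M Ms n i \<omega>)) / real (card (M \<omega>)) *
     cos_sim x (masked_ratings M Xs Ms n i \<omega>)"

text \<open>The convention \<open>0 \<times> \<infinity> = 0\<close> for \<open>X_i^(n) = 0\<close> is met because division by 0 gives 0.\<close>

definition knn_estimate ::
  "('a \<Rightarrow> 'd::finite set) \<Rightarrow> (nat \<Rightarrow> 'a \<Rightarrow> real ^ 'd) \<Rightarrow> (nat \<Rightarrow> 'a \<Rightarrow> real) \<Rightarrow>
     (nat \<Rightarrow> nat \<Rightarrow> 'a \<Rightarrow> 'd set) \<Rightarrow> (nat \<Rightarrow> 'a \<Rightarrow> nat set) \<Rightarrow> (nat \<Rightarrow> nat) \<Rightarrow>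
     nat \<Rightarrow> real ^ 'd \<Rightarrow> 'a \<Rightarrow> real" where
  "knn_estimate M Xs Ys Ms R k n x \<omega> =
     norm x *
     (\<Sum>i\<in>R n \<omega>.
        knn_weight (k n) (R n \<omega>)
          (\<lambda>i. masked_ratings M Xs Ms n i \<omega>) (\<lambda>i. similarity M Xs Ms n x i \<omega>) i *
        (Ys i \<omega> / norm (masked_ratings M Xs Ms n i \<omega>)))"

text \<open>The random quantities that are required to be mutually independent.\<close>

datatype source = New_Mask | Ratings nat | Mask_Seq nat

definition source_events ::
  "'a measure \<Rightarrow> ('a \<Rightarrow> 'd::finite set) \<Rightarrow> (nat \<Rightarrow> 'a \<Rightarrow> real ^ 'd) \<Rightarrow> (nat \<Rightarrow> 'a \<Rightarrow> real) \<Rightarrow>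
     (nat \<Rightarrow> nat \<Rightarrow> 'a \<Rightarrow> 'd set) \<Rightarrow> source \<Rightarrow> 'a set set" where
  "source_events P M Xs Ys Ms q =
     (case q of
        New_Mask \<Rightarrow> gen_sets P mask_space M
      | Ratings i \<Rightarrow> gen_sets P borel (\<lambda>\<omega>. (Xs i \<omega>, Ys i \<omega>))
      | Mask_Seq i \<Rightarrow> gen_sets P mask_seq_space (\<lambda>\<omega>. \<lambda>n\<in>{1..}. Ms i n \<omega>))"

text \<open>The whole database, over all times: the ratings of all users, all their masks, and the
  sets \<open>R_n\<close>.\<close>

abbreviation all_masks_space :: "(nat \<Rightarrow> nat \<Rightarrow> 'd::finite set) measure" where
  "all_masks_space \<equiv> PiM {1..} (\<lambda>_. mask_seq_space)"

definition all_masks ::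
  "(nat \<Rightarrow> nat \<Rightarrow> 'a \<Rightarrow> 'd::finite set) \<Rightarrow> 'a \<Rightarrow> nat \<Rightarrow> nat \<Rightarrow> 'd set" where
  "all_masks Ms \<omega> = (\<lambda>i\<in>{1..}. \<lambda>n\<in>{1..}. Ms i n \<omega>)"

definition database_events ::
  "'a measure \<Rightarrow> (nat \<Rightarrow> 'a \<Rightarrow> real ^ 'd::finite) \<Rightarrow> (nat \<Rightarrow> 'a \<Rightarrow> real) \<Rightarrow>
     (nat \<Rightarrow> nat \<Rightarrow> 'a \<Rightarrow> 'd set) \<Rightarrow> (nat \<Rightarrow> 'a \<Rightarrow> nat set) \<Rightarrow> 'a set set" where
  "database_events P Xs Ys Ms R =
     gen_sets P
       (PiM {1..} (\<lambda>_. borel) \<Otimes>\<^sub>M all_masks_space \<Otimes>\<^sub>M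
          PiM {1..} (\<lambda>n. count_space (Pstar {1..n})))
       (\<lambda>\<omega>. (\<lambda>i\<in>{1..}. (Xs i \<omega>, Ys i \<omega>), all_masks Ms \<omega>, \<lambda>n\<in>{1..}. R n \<omega>))"

text \<open>\<open>G\<close> is the generic mask sequence and \<open>n0\<close> the random time from which on it is full.

  The assumption \<open>new_user\<close> makes explicit in which sense the new user is not part of the
  database: given the mask \<open>M\<close>, its ratings \<open>(X, Y)\<close> are independent of the database. This
  follows if \<open>(X, Y)\<close> is independent of \<open>M\<close> and the database taken together, and also if
  \<open>(X, Y, M)\<close> is independent of the database.\<close>

locale recommendation_model = prob_space P
  for P :: "'a measure" +
  fixes s :: real
    and X :: "'a \<Rightarrow> real ^ 'd::finite" and Y :: "'a \<Rightarrow> real" and M :: "'a \<Rightarrow> 'd set"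
    and Xs :: "nat \<Rightarrow> 'a \<Rightarrow> real ^ 'd" and Ys :: "nat \<Rightarrow> 'a \<Rightarrow> real"
    and Ms :: "nat \<Rightarrow> nat \<Rightarrow> 'a \<Rightarrow> 'd set"
    and G :: "nat \<Rightarrow> 'a \<Rightarrow> 'd set" and n0 :: "'a \<Rightarrow> nat"
    and R :: "nat \<Rightarrow> 'a \<Rightarrow> nat set" and k :: "nat \<Rightarrow> nat"
  assumes s_gt_1: "s > 1"
    and X_rv: "random_variable borel X"
    and Y_rv: "random_variable borel Y"
    and X_range: "\<And>\<omega> j. \<omega> \<in> space P \<Longrightarrow> X \<omega> $ j \<in> {1..s}"
    and Y_range: "\<And>\<omega>. \<omega> \<in> space P \<Longrightarrow> Y \<omega> \<in> {1..s}"
    and M_rv: "random_variable mask_space M"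
    and Xs_rv: "\<And>i. i \<ge> 1 \<Longrightarrow> random_variable borel (Xs i)"
    and Ys_rv: "\<And>i. i \<ge> 1 \<Longrightarrow> random_variable borel (Ys i)"
    and ratings_distr: "\<And>i. i \<ge> 1 \<Longrightarrow>
          distr P borel (\<lambda>\<omega>. (Xs i \<omega>, Ys i \<omega>)) = distr P borel (\<lambda>\<omega>. (X \<omega>, Y \<omega>))"
    and Ms_process: "\<And>i. i \<ge> 1 \<Longrightarrow> mask_process P (Ms i)"
    and G_process: "mask_process P G"
    and Ms_distr: "\<And>i. i \<ge> 1 \<Longrightarrow>
          distr P mask_seq_space (\<lambda>\<omega>. \<lambda>n\<in>{1..}. Ms i n \<omega>) =
          distr P mask_seq_space (\<lambda>\<omega>. \<lambda>n\<in>{1..}. G n \<omega>)"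
    and n0_rv: "random_variable (count_space {1..}) n0"
    and G_full: "\<And>\<omega> n. \<omega> \<in> space P \<Longrightarrow> n \<ge> n0 \<omega> \<Longrightarrow> G n \<omega> = UNIV"
    and M_distr: "distr P mask_space M = distr P mask_space (G 1)"
    and indep: "indep_sets (source_events P M Xs Ys Ms)
                  ({New_Mask} \<union> Ratings ` {1..} \<union> Mask_Seq ` {1..})"
    and R_rv: "\<And>n. n \<ge> 1 \<Longrightarrow> random_variable (count_space (Pstar {1..n})) (R n)"
    and R_mono: "\<And>n \<omega>. n \<ge> 1 \<Longrightarrow> \<omega> \<in> space P \<Longrightarrow> R n \<omega> \<subseteq> R (Suc n) \<omega>"
    and R_indep: "\<And>n. n \<ge> 1 \<Longrightarrow>
          indep_set (gen_sets P (count_space (Pstar {1..n})) (R n))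
            (gen_sets P (mask_space \<Otimes>\<^sub>M all_masks_space) (\<lambda>\<omega>. (M \<omega>, all_masks Ms \<omega>)))"
    and k_range: "\<And>n. n \<ge> 1 \<Longrightarrow> k n \<in> {1..n}"
    and new_user: "\<And>m. prob {\<omega> \<in> space P. M \<omega> = m} > 0 \<Longrightarrow>
          prob_space.indep_set (uniform_measure P {\<omega> \<in> space P. M \<omega> = m})
            (gen_sets P borel (\<lambda>\<omega>. (X \<omega>, Y \<omega>)))
            (database_events P Xs Ys Ms R)"

definition tendsto_in_prob ::
  "'a measure \<Rightarrow> (nat \<Rightarrow> 'a \<Rightarrow> real) \<Rightarrow> ('a \<Rightarrow> real) \<Rightarrow> bool" where
  "tendsto_in_prob P Z L \<longleftrightarrow>
     (\<forall>\<epsilon>>0. (\<lambda>n. measure P {\<omega> \<in> space P. \<bar>Z n \<omega> - L \<omega>\<bar> > \<epsilon>}) \<longlonglongrightarrow> 0)"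

text \<open>Conditional expectation given a random vector. Like \<^const>\<open>real_cond_exp\<close> it is a
  function on \<^term>\<open>space P\<close>.\<close>

definition cond_exp_given ::
  "'a measure \<Rightarrow> ('a \<Rightarrow> real) \<Rightarrow> ('a \<Rightarrow> 'b::topological_space) \<Rightarrow> 'a \<Rightarrow> real" where
  "cond_exp_given P Z V = real_cond_exp P (vimage_algebra (space P) V borel) Z"

text \<open>\<open>\<eta>(v) = E[Z | V = v]\<close>: \<open>\<eta>\<close> is a version of the regression function.\<close>

definition is_regression_fun ::
  "'a measure \<Rightarrow> ('a \<Rightarrow> real) \<Rightarrow> ('a \<Rightarrow> 'b::topological_space) \<Rightarrow> ('b \<Rightarrow> real) \<Rightarrow> bool" where
  "is_regression_fun P Z V \<eta> \<longleftrightarrow>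
     \<eta> \<in> borel_measurable borel \<and> (AE \<omega> in P. \<eta> (V \<omega>) = cond_exp_given P Z V \<omega>)"

end

theory Submission
  imports Defs
begin

text \<open>Cosine similarity does not see the length of its arguments, so \<open>\<eta>\<^sub>n(X\<^sup>\<star>) / |X\<^sup>\<star>|\<close> is a function of
  the direction \<open>X\<^sup>\<star> / |X\<^sup>\<star>|\<close>, of \<open>M\<close> and of the database. Along a subsequence it converges
  almost surely to \<open>\<eta>(X\<^sup>\<star>) / |X\<^sup>\<star>|\<close>. Given \<open>M = m\<close> the database is independent of \<open>X\<^sup>\<star>\<close>, so by
  Fubini it can be frozen at a fixed state without losing the almost sure limit. As ratings are
  positive, \<open>m\<close> is the support of the direction, and hence \<open>\<eta>(X\<^sup>\<star>) / |X\<^sup>\<star>|\<close> is almost surely a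
  function of the direction alone. Conditioning on the direction then gives the claim.\<close>

section \<open>Scale invariance of the similarity and of the estimate\<close>

text \<open>Sums over the fixed index set \<open>UNIV\<close> replace sums over a set depending on
  the arguments, which suits both rescaling and measurability. The case distinction disappears:
  without common coordinates the numerator is 0, and so is the quotient.\<close>

lemma cos_sim_altdef:
  "cos_sim x y = (\<Sum>j\<in>UNIV. x $ j * y $ j) /
     (sqrt (\<Sum>j\<in>UNIV. if x $ j \<noteq> 0 \<and> y $ j \<noteq> 0 then (x $ j)\<^sup>2 else 0) *
      sqrt (\<Sum>j\<in>UNIV. if x $ j \<noteq> 0 \<and> y $ j \<noteq> 0 then (y $ j)\<^sup>2 else 0))"
proof -
  let ?J = "{j. x $ j \<noteq> 0 \<and> y $ j \<noteq> 0}"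
  have "(\<Sum>j\<in>?J. x $ j * y $ j) = (\<Sum>j\<in>UNIV. x $ j * y $ j)"
    by (rule sum.mono_neutral_left) auto
  moreover have "(\<Sum>j\<in>?J. f j) = (\<Sum>j\<in>UNIV. if x $ j \<noteq> 0 \<and> y $ j \<noteq> 0 then f j else 0)"
    for f :: "'a \<Rightarrow> real"
    using sum.inter_filter[of UNIV f "\<lambda>j. x $ j \<noteq> 0 \<and> y $ j \<noteq> 0"] by simp
  moreover have "(\<Sum>j\<in>UNIV. x $ j * y $ j) = 0" if "?J = {}"
    using that by (intro sum.neutral) auto
  ultimately show ?thesis
    unfolding cos_sim_def Let_def by (cases "?J = {}") simp_all
qed

lemma cos_sim_scaleR:
  assumes "c > 0"
  shows "cos_sim (c *\<^sub>R x) y = cos_sim x y"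
proof -
  have "(\<Sum>j\<in>UNIV. if Q j then (c * x $ j)\<^sup>2 else 0) =
      c\<^sup>2 * (\<Sum>j\<in>UNIV. if Q j then (x $ j)\<^sup>2 else 0)" for Q
    unfolding sum_distrib_left by (intro sum.cong) (auto simp: power_mult_distrib)
  moreover have "(\<Sum>j\<in>UNIV. c * x $ j * y $ j) = c * (\<Sum>j\<in>UNIV. x $ j * y $ j)"
    by (simp add: mult.assoc sum_distrib_left)
  ultimately show ?thesis
    unfolding cos_sim_altdef vector_scaleR_component real_scaleR_def
    using assms by (simp add: real_sqrt_mult)
qed

text \<open>All similarities, hence the ranking and the weights, ignore the length of
  \<open>x\<close>; only the leading factor \<open>norm x\<close> scales. Dividing the estimate at
  \<open>x\<close> by \<open>norm x\<close> thus gives the estimate at the direction of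
  \<open>x\<close>.\<close>

lemma knn_estimate_scaleR:
  assumes "c > 0"
  shows "knn_estimate M Xs Ys Ms R k n (c *\<^sub>R x) \<omega> = c * knn_estimate M Xs Ys Ms R k n x \<omega>"
  using assms by (simp add: knn_estimate_def similarity_def cos_sim_scaleR mult.assoc)

section \<open>Measurability of the estimate\<close>

lemma measurable_real_card:
  assumes [measurable]: "\<And>j. Measurable.pred N (\<lambda>\<omega>. j \<in> A \<omega>)"
    and sub: "\<And>\<omega>. \<omega> \<in> space N \<Longrightarrow> A \<omega> \<subseteq> B" and B: "finite B"
  shows "(\<lambda>\<omega>. real (card (A \<omega>))) \<in> borel_measurable N"
proof -
  have "(\<lambda>\<omega>. \<Sum>j\<in>B. if j \<in> A \<omega> then 1 else 0 :: real) \<in> borel_measurable N"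
    by measurable
  moreover have "(\<Sum>j\<in>B. if j \<in> A \<omega> then 1 else 0 :: real) = real (card (A \<omega>))"
    if "\<omega> \<in> space N" for \<omega>
  proof -
    have "{j \<in> B. j \<in> A \<omega>} = A \<omega>"
      using sub[OF that] by auto
    with sum.inter_filter[OF B, of "\<lambda>_. 1::real" "\<lambda>j. j \<in> A \<omega>"] show ?thesis
      by simp
  qed
  ultimately show ?thesis
    by (simp cong: measurable_cong)
qed

text \<open>The space \<open>N\<close> is arbitrary and the random sets enter only through
  membership predicates. The lemma then serves both on \<open>P\<close> with the random mask and on
  pairs of a query point and a database state with a constant mask.\<close>

lemma measurable_knn_estimate:
  fixes Xs :: "nat \<Rightarrow> 'a \<Rightarrow> real ^ 'd::finite"
  assumes [measurable]: "u \<in> borel_measurable N"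
    "\<And>i. i \<in> {1..n} \<Longrightarrow> Xs i \<in> borel_measurable N"
    "\<And>i. i \<in> {1..n} \<Longrightarrow> Ys i \<in> borel_measurable N"
    "\<And>j. Measurable.pred N (\<lambda>\<omega>. j \<in> M \<omega>)"
    "\<And>i j. i \<in> {1..n} \<Longrightarrow> Measurable.pred N (\<lambda>\<omega>. j \<in> Ms i (n + 1 - i) \<omega>)"
    "\<And>l. Measurable.pred N (\<lambda>\<omega>. l \<in> R n \<omega>)"
    and sub: "\<And>\<omega>. \<omega> \<in> space N \<Longrightarrow> R n \<omega> \<subseteq> {1..n}"
  shows "(\<lambda>\<omega>. knn_estimate M Xs Ys Ms R k n (u \<omega>) \<omega>) \<in> borel_measurable N"
proof -
  define V where "V i \<omega> = masked_ratings M Xs Ms n i \<omega>" for i \<omega>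
  define S where "S i \<omega> = similarity M Xs Ms n (u \<omega>) i \<omega>" for i \<omega>
  have component [measurable]: "(\<lambda>\<omega>. f \<omega> $ j) \<in> borel_measurable N"
    if "f \<in> borel_measurable N" for f :: "'a \<Rightarrow> real ^ 'd" and j
    by (rule measurable_compose[OF that borel_measurable_nth])
  have common [measurable]: "Measurable.pred N (\<lambda>\<omega>. j \<in> common_mask M Ms n i \<omega>)"
    if "i \<in> {1..n}" for i j
    unfolding common_mask_def Int_iff using that by (intro pred_intros_logic assms)
  have V_nth [measurable]: "(\<lambda>\<omega>. V i \<omega> $ j) \<in> borel_measurable N" if "i \<in> {1..n}" for i j
    unfolding V_def masked_ratings_def masked_def vec_lambda_beta using that by measurable
  have norm_V [measurable]: "(\<lambda>\<omega>. norm (V i \<omega>)) \<in> borel_measurable N" if "i \<in> {1..n}" for i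
    unfolding norm_vec_def L2_set_def using that by measurable
  have S [measurable]: "S i \<in> borel_measurable N" if "i \<in> {1..n}" for i
  proof -
    have [measurable]: "(\<lambda>\<omega>. cos_sim (u \<omega>) (V i \<omega>)) \<in> borel_measurable N"
      unfolding cos_sim_altdef using that by measurable
    have [measurable]: "(\<lambda>\<omega>. real (card (common_mask M Ms n i \<omega>))) \<in> borel_measurable N"
      by (intro measurable_real_card[where B = UNIV] common that) auto
    have [measurable]: "(\<lambda>\<omega>. real (card (M \<omega>))) \<in> borel_measurable N"
      by (intro measurable_real_card[where B = UNIV]) auto
    show ?thesis
      unfolding S_def similarity_def V_def[symmetric] by measurable
  qed
  have w [measurable]:
    "(\<lambda>\<omega>. knn_weight (k n) (R n \<omega>) (\<lambda>i. V i \<omega>) (\<lambda>i. S i \<omega>) i) \<in> borel_measurable N"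
    if i: "i \<in> {1..n}" for i
  proof -
    have "Measurable.pred N (\<lambda>\<omega>. l \<in> {l \<in> R n \<omega>. S l \<omega> > S i \<omega> \<or> (S l \<omega> = S i \<omega> \<and> l < i)})" for l
    proof (cases "l \<in> {1..n}")
      case True
      then show ?thesis using i by simp
    next
      case False
      have "l \<notin> R n \<omega>" if "\<omega> \<in> space N" for \<omega>
        using sub[OF that] False by auto
      then have "Measurable.pred N (\<lambda>\<omega>. False) \<longleftrightarrow>
          Measurable.pred N (\<lambda>\<omega>. l \<in> {l \<in> R n \<omega>. S l \<omega> > S i \<omega> \<or> (S l \<omega> = S i \<omega> \<and> l < i)})"
        by (intro measurable_cong) auto
      then show ?thesis by simp
    qed
    then have [measurable]:
      "(\<lambda>\<omega>. real (card {l \<in> R n \<omega>. S l \<omega> > S i \<omega> \<or> (S l \<omega> = S i \<omega> \<and> l < i)}))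
         \<in> borel_measurable N"
      using sub by (intro measurable_real_card[where B = "{1..n}"]) auto
    have [measurable]: "(\<lambda>\<omega>. real (card (R n \<omega>))) \<in> borel_measurable N"
      using sub by (intro measurable_real_card[where B = "{1..n}"]) auto
    \<comment> \<open>The conditions are restated through \<open>norm (V i \<omega>)\<close> and
      real-valued cardinalities, whose measurability is established.\<close>
    have eq: "knn_weight (k n) (R n \<omega>) (\<lambda>i. V i \<omega>) (\<lambda>i. S i \<omega>) i =
      (if i \<in> R n \<omega> \<and> real (k n) \<le> real (card (R n \<omega>)) \<and> norm (V i \<omega>) \<noteq> 0 \<and>
         real (card {l \<in> R n \<omega>. S l \<omega> > S i \<omega> \<or> (S l \<omega> = S i \<omega> \<and> l < i)}) < real (k n)
       then 1 / real (k n) else 0)" for \<omega>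
      by (simp add: knn_weight_def)
    show ?thesis
      unfolding eq using i by measurable
  qed
  \<comment> \<open>Weights vanish outside \<open>R n \<omega>\<close>, so the random range of
    summation can be replaced by \<open>{1..n}\<close>.\<close>
  have "knn_estimate M Xs Ys Ms R k n (u \<omega>) \<omega> = norm (u \<omega>) *
      (\<Sum>i\<in>{1..n}. knn_weight (k n) (R n \<omega>) (\<lambda>i. V i \<omega>) (\<lambda>i. S i \<omega>) i *
        (Ys i \<omega> / norm (V i \<omega>)))" if "\<omega> \<in> space N" for \<omega>
    unfolding knn_estimate_def V_def S_def
    using sub[OF that]
    by (intro arg_cong2[where f = "(*)"] refl sum.mono_neutral_left) (auto simp: knn_weight_def)
  moreover have "(\<lambda>\<omega>. norm (u \<omega>) *
      (\<Sum>i\<in>{1..n}. knn_weight (k n) (R n \<omega>) (\<lambda>i. V i \<omega>) (\<lambda>i. S i \<omega>) i *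
        (Ys i \<omega> / norm (V i \<omega>)))) \<in> borel_measurable N"
    by measurable
  ultimately show ?thesis
    by (simp cong: measurable_cong)
qed

section \<open>Almost sure limits and freezing of an independent argument\<close>

text \<open>Borel-Cantelli: \<open>r n\<close> is chosen such that a deviation above
  \<open>(1 / 2) ^ n\<close> has probability below \<open>(1 / 2) ^ n\<close>, which is summable.
  The indices \<open>r n\<close> may repeat or decrease; the aim is only to express \<open>L\<close>
  as a pointwise limit of variables \<open>Z m\<close>.\<close>

lemma (in prob_space) tendsto_in_prob_imp_AE_subseq:
  assumes "tendsto_in_prob M Z L"
    and [measurable]: "\<And>n. random_variable borel (Z n)" "random_variable borel L"
  shows "\<exists>r. AE \<omega> in M. (\<lambda>n. Z (r n) \<omega>) \<longlonglongrightarrow> L \<omega>"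
proof -
  have "\<exists>m. prob {\<omega> \<in> space M. \<bar>Z m \<omega> - L \<omega>\<bar> > (1 / 2) ^ n} < (1 / 2) ^ n" for n
  proof -
    have "(\<lambda>m. prob {\<omega> \<in> space M. \<bar>Z m \<omega> - L \<omega>\<bar> > (1 / 2) ^ n}) \<longlonglongrightarrow> 0"
      using assms(1) by (simp add: tendsto_in_prob_def)
    then have "eventually (\<lambda>m. prob {\<omega> \<in> space M. \<bar>Z m \<omega> - L \<omega>\<bar> > (1 / 2) ^ n} < (1 / 2) ^ n)
        sequentially"
      by (rule order_tendstoD) simp
    then show ?thesis
      by (auto simp: eventually_sequentially)
  qed
  then obtain r where
    r: "\<And>n. prob {\<omega> \<in> space M. \<bar>Z (r n) \<omega> - L \<omega>\<bar> > (1 / 2) ^ n} < (1 / 2) ^ n"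
    by metis
  let ?A = "\<lambda>n. {\<omega> \<in> space M. \<bar>Z (r n) \<omega> - L \<omega>\<bar> > (1 / 2) ^ n}"
  have "summable (\<lambda>n. prob (?A n))"
  proof (rule summable_comparison_test')
    show "summable (\<lambda>n. (1 / 2 :: real) ^ n)"
      by (rule summable_geometric) simp
    show "norm (prob (?A n)) \<le> (1 / 2) ^ n" for n
      using r[of n] by simp
  qed
  then have "AE \<omega> in M. eventually (\<lambda>n. \<omega> \<in> space M - ?A n) sequentially"
    by (intro borel_cantelli_AE1) (auto simp: emeasure_eq_measure)
  then have "AE \<omega> in M. (\<lambda>n. Z (r n) \<omega>) \<longlonglongrightarrow> L \<omega>"
  proof eventually_elim
    case (elim \<omega>)
    have "(\<lambda>n. Z (r n) \<omega> - L \<omega>) \<longlonglongrightarrow> 0"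
    proof (rule Lim_null_comparison)
      show "eventually (\<lambda>n. norm (Z (r n) \<omega> - L \<omega>) \<le> (1 / 2) ^ n) sequentially"
        using elim by eventually_elim auto
      show "(\<lambda>n. (1 / 2 :: real) ^ n) \<longlonglongrightarrow> 0"
        by (rule LIMSEQ_power_zero) simp
    qed
    then show ?case
      by (simp add: LIM_zero_iff)
  qed
  then show ?thesis by blast
qed

text \<open>Fubini: \<open>N\<close> is a sigma-algebra on the same sample space, so its random
  element is the identity. By independence the joint law of \<open>U\<close> and the identity is a
  product, and almost every \<open>\<omega>'\<close> has an almost sure section.\<close>

lemma (in prob_space) indep_set_imp_frozen_AE:
  assumes indep: "indep_set (gen_sets M S U) (sets N)" and space_N: "space N = space M"
    and U: "random_variable S U"
    and Q [measurable]: "Measurable.pred (S \<Otimes>\<^sub>M N) Q"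
    and ae: "AE \<omega> in M. Q (U \<omega>, \<omega>)"
  shows "\<exists>\<omega>'\<in>space M. AE \<omega> in M. Q (U \<omega>, \<omega>')"
proof -
  have N: "(\<lambda>\<omega>. \<omega>) \<in> M \<rightarrow>\<^sub>M N"
  proof (rule measurableI)
    fix A assume A: "A \<in> sets N"
    have "sets N \<subseteq> events"
      using indep by (rule indep_setD_ev2)
    with A sets.sets_into_space[OF A] space_N show "(\<lambda>\<omega>. \<omega>) -` A \<inter> space M \<in> events"
      by (auto simp: Int_absorb2)
  qed (simp add: space_N)
  interpret U: prob_space "distr M S U"
    by (rule prob_space_distr) (rule U)
  interpret N: prob_space "distr M N (\<lambda>\<omega>. \<omega>)"
    by (rule prob_space_distr) (rule N)
  interpret UN: pair_sigma_finite "distr M S U" "distr M N (\<lambda>\<omega>. \<omega>)" ..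
  \<comment> \<open>A product measure is determined by its values on rectangles, where the identity
    is the product rule for independent events.\<close>
  have eq: "distr M S U \<Otimes>\<^sub>M distr M N (\<lambda>\<omega>. \<omega>) = distr M (S \<Otimes>\<^sub>M N) (\<lambda>\<omega>. (U \<omega>, \<omega>))"
  proof (rule pair_measure_eqI)
    fix A B assume "A \<in> sets (distr M S U)" "B \<in> sets (distr M N (\<lambda>\<omega>. \<omega>))"
    then have A: "A \<in> sets S" and B: "B \<in> sets N" by simp_all
    have "U -` A \<inter> space M \<in> gen_sets M S U"
      unfolding gen_sets_def using A by (rule in_vimage_algebra)
    with indep B have "prob ((U -` A \<inter> space M) \<inter> B) = prob (U -` A \<inter> space M) * prob B"
      by (intro indep_setD)
    moreover have "(\<lambda>\<omega>. (U \<omega>, \<omega>)) -` (A \<times> B) \<inter> space M = (U -` A \<inter> space M) \<inter> B"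
      "(\<lambda>\<omega>. \<omega>) -` B \<inter> space M = B"
      using sets.sets_into_space[OF B] by (auto simp: space_N)
    ultimately show "emeasure (distr M S U) A * emeasure (distr M N (\<lambda>\<omega>. \<omega>)) B =
        emeasure (distr M (S \<Otimes>\<^sub>M N) (\<lambda>\<omega>. (U \<omega>, \<omega>))) (A \<times> B)"
      using A B U N
      by (simp add: emeasure_distr emeasure_eq_measure ennreal_mult'[symmetric])
  qed (auto intro: U.sigma_finite_measure_axioms N.sigma_finite_measure_axioms
      cong: sets_pair_measure_cong)
  have "AE z in distr M S U \<Otimes>\<^sub>M distr M N (\<lambda>\<omega>. \<omega>). Q z"
    unfolding eq using ae U N by (subst AE_distr_iff) auto
  then have "AE x in distr M S U. AE \<omega>' in distr M N (\<lambda>\<omega>. \<omega>). Q (x, \<omega>')"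
    by (rule UN.AE_pair)
  then have *: "AE \<omega>' in distr M N (\<lambda>\<omega>. \<omega>). AE x in distr M S U. Q (x, \<omega>')"
    using Q by (subst (asm) UN.AE_commute) (simp_all add: pred_def space_pair_measure)
  show ?thesis
  proof (rule ccontr)
    assume "\<not> ?thesis"
    \<comment> \<open>Without a suitable \<open>\<omega>'\<close> the almost sure property
      \<open>*\<close> would fail at every point, which is impossible under a probability
      measure.\<close>
    then have "\<not> (AE x in distr M S U. Q (x, \<omega>'))" if "\<omega>' \<in> space M" for \<omega>'
      using that AE_distrD[OF U] by blast
    then have "AE \<omega>' in distr M N (\<lambda>\<omega>. \<omega>). \<not> (AE x in distr M S U. Q (x, \<omega>'))"
      by (intro AE_I2) (simp add: space_N)
    from eventually_conj[OF * this] show False by simp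
  qed
qed

section \<open>Conditioning on the direction of a random vector\<close>

lemma subalgebra_vimage_algebra:
  assumes f: "f \<in> measurable N S"
  shows "subalgebra N (vimage_algebra (space N) f S)"
proof -
  have "f \<in> space N \<rightarrow> space S"
    using f by (auto dest: measurable_space)
  then show ?thesis
    using measurable_sets[OF f] by (auto simp: subalgebra_def sets_vimage_algebra2)
qed

text \<open>Conditioning \<open>E[Y / |V| | V] = \<eta>(V) / |V|\<close> further on the direction of \<open>V\<close> changes
  nothing, because the right-hand side depends on that direction only.\<close>

lemma (in prob_space) regression_direction:
  fixes V :: "'a \<Rightarrow> 'b::euclidean_space"
  assumes V [measurable]: "random_variable borel V" and nz: "\<And>\<omega>. \<omega> \<in> space M \<Longrightarrow> V \<omega> \<noteq> 0"
    and Y [measurable]: "random_variable borel Y"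
    and int: "integrable M (\<lambda>\<omega>. Y \<omega> / norm (V \<omega>))"
    and reg: "is_regression_fun M Y V \<eta>"
    and g [measurable]: "g \<in> borel_measurable borel"
    and dir: "AE \<omega> in M. \<eta> (V \<omega>) / norm (V \<omega>) = g (V \<omega> /\<^sub>R norm (V \<omega>))"
  shows "AE \<omega> in M. \<eta> (V \<omega>) =
    norm (V \<omega>) * cond_exp_given M (\<lambda>\<omega>. Y \<omega> / norm (V \<omega>)) (\<lambda>\<omega>. V \<omega> /\<^sub>R norm (V \<omega>)) \<omega>"
proof -
  define F where "F = vimage_algebra (space M) V borel"
  define U where "U = (\<lambda>\<omega>. V \<omega> /\<^sub>R norm (V \<omega>))"
  define H where "H = vimage_algebra (space M) U borel"
  have U [measurable]: "random_variable borel U"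
    unfolding U_def by measurable
  have VF [measurable]: "V \<in> borel_measurable F"
    unfolding F_def by (rule measurable_vimage_algebra1) simp
  have UF: "U \<in> borel_measurable F"
    unfolding U_def by measurable
  have UH [measurable]: "U \<in> borel_measurable H"
    unfolding H_def by (rule measurable_vimage_algebra1) simp
  have subF: "subalgebra M F" and subH: "subalgebra M H"
    unfolding F_def H_def by (rule subalgebra_vimage_algebra; measurable)+
  \<comment> \<open>The direction \<open>U\<close> is a function of \<open>V\<close>, so it
    generates a coarser sigma-algebra and the tower property applies.\<close>
  have subFH: "subalgebra F H"
    using subalgebra_vimage_algebra[OF UF] by (simp add: H_def F_def)
  interpret F: finite_measure_subalgebra M F
    by unfold_locales (rule subF)
  interpret H: finite_measure_subalgebra M H
    by unfold_locales (rule subH)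
  let ?Z = "\<lambda>\<omega>. Y \<omega> / norm (V \<omega>)"
  \<comment> \<open>The factor \<open>1 / norm (V \<omega>)\<close> is \<open>F\<close>-measurable
    and can be taken out of the conditional expectation.\<close>
  have "AE \<omega> in M. real_cond_exp M F (\<lambda>\<omega>. 1 / norm (V \<omega>) * Y \<omega>) \<omega> =
      1 / norm (V \<omega>) * real_cond_exp M F Y \<omega>"
    using int by (intro F.real_cond_exp_mult) auto
  then have Z: "AE \<omega> in M. real_cond_exp M F ?Z \<omega> = g (U \<omega>)"
    using dir reg[unfolded is_regression_fun_def cond_exp_given_def, THEN conjunct2]
    by eventually_elim (simp add: F_def U_def)
  \<comment> \<open>Being only Borel, \<open>g\<close> gives no bound; integrability is inherited
    from the conditional expectation with which \<open>g (U \<omega>)\<close> agrees almost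
    surely.\<close>
  have int_g: "integrable M (\<lambda>\<omega>. g (U \<omega>))"
    using F.real_cond_exp_int(1)[OF int]
    by (rule integrable_cong_AE_imp) (use Z in \<open>auto simp: eq_commute\<close>)
  have "AE \<omega> in M. real_cond_exp M H (real_cond_exp M F ?Z) \<omega> = real_cond_exp M H ?Z \<omega>"
    by (rule H.real_cond_exp_nested_subalg) (fact subF subFH int)+
  moreover have "AE \<omega> in M. real_cond_exp M H (real_cond_exp M F ?Z) \<omega> =
      real_cond_exp M H (\<lambda>\<omega>. g (U \<omega>)) \<omega>"
    by (rule H.real_cond_exp_cong) (use Z in auto)
  moreover have "AE \<omega> in M. real_cond_exp M H (\<lambda>\<omega>. g (U \<omega>)) \<omega> = g (U \<omega>)"
    using int_g by (rule H.real_cond_exp_F_meas) measurable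
  ultimately show ?thesis
    using dir AE_space
    by eventually_elim (auto simp: cond_exp_given_def H_def U_def field_simps dest: nz)
qed

section \<open>Generated sigma-algebras, masking and substitution in the estimate\<close>

lemma gen_sets_compose_subset:
  assumes f: "f \<in> measurable S T" and Z: "Z \<in> space P \<rightarrow> space S"
  shows "gen_sets P T (\<lambda>\<omega>. f (Z \<omega>)) \<subseteq> gen_sets P S Z"
proof
  fix B assume B: "B \<in> gen_sets P T (\<lambda>\<omega>. f (Z \<omega>))"
  have "(\<lambda>\<omega>. f (Z \<omega>)) \<in> space P \<rightarrow> space T"
    using assms by (auto dest: measurable_space)
  with B obtain A where A: "A \<in> sets T" "B = (\<lambda>\<omega>. f (Z \<omega>)) -` A \<inter> space P"
    unfolding gen_sets_def by (subst (asm) sets_vimage_algebra2) auto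
  have "B = Z -` (f -` A \<inter> space S) \<inter> space P"
    using A Z by auto
  then show "B \<in> gen_sets P S Z"
    unfolding gen_sets_def using measurable_sets[OF f A(1)] by (simp only: in_vimage_algebra)
qed

lemma borel_measurable_masked:
  fixes A :: "'b::finite set"
  shows "masked A \<in> borel_measurable borel"
proof (rule borel_measurable_continuous_onI)
  have "continuous_on UNIV (\<lambda>x :: real ^ 'b. \<chi> j. if j \<in> A then x $ j else 0)"
  proof (rule continuous_on_vec_lambda)
    show "continuous_on UNIV (\<lambda>x :: real ^ 'b. if j \<in> A then x $ j else 0)" for j
      by (cases "j \<in> A") (simp_all add: continuous_on_component)
  qed
  then show "continuous_on UNIV (masked A)"
    by (simp add: masked_def[abs_def])
qed

text \<open>The estimate reads its random inputs at one sample point only. With \<open>snd\<close>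
  for \<open>f\<close> it becomes a function on the product with the database.\<close>

lemma knn_estimate_reindex:
  "knn_estimate (\<lambda>z. M (f z)) (\<lambda>i z. Xs i (f z)) (\<lambda>i z. Ys i (f z)) (\<lambda>i n z. Ms i n (f z))
     (\<lambda>n z. R n (f z)) k n x z = knn_estimate M Xs Ys Ms R k n x (f z)"
  by (simp add: knn_estimate_def similarity_def masked_ratings_def common_mask_def)

lemma knn_estimate_mask_cong:
  "M \<omega> = M' \<omega> \<Longrightarrow> knn_estimate M Xs Ys Ms R k n x \<omega> = knn_estimate M' Xs Ys Ms R k n x \<omega>"
  by (simp add: knn_estimate_def similarity_def masked_ratings_def common_mask_def)

section \<open>The database as a sigma-algebra on the sample space\<close>

context recommendation_model
begin

text \<open>The sigma-algebra \<open>database_events\<close> as a measure object, so that it can be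
  a factor of a product and a domain for measurability. The generating map does not include the new
  user's mask \<open>M\<close>.\<close>

definition database :: "'a measure" where
  "database = vimage_algebra (space P)
     (\<lambda>\<omega>. (\<lambda>i\<in>{1..}. (Xs i \<omega>, Ys i \<omega>), all_masks Ms \<omega>, \<lambda>n\<in>{1..}. R n \<omega>))
     (PiM {1..} (\<lambda>_. borel) \<Otimes>\<^sub>M all_masks_space \<Otimes>\<^sub>M PiM {1..} (\<lambda>n. count_space (Pstar {1..n})))"

lemma sets_database: "sets database = database_events P Xs Ys Ms R"
  by (simp add: database_def database_events_def gen_sets_def)

lemma space_database [simp]: "space database = space P"
  by (simp add: database_def)

lemma M_pred: "Measurable.pred P (\<lambda>\<omega>. j \<in> M \<omega>)"
  by (rule measurable_compose[OF M_rv]) simp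

lemma M_nonempty: "\<omega> \<in> space P \<Longrightarrow> M \<omega> \<noteq> {}"
  using measurable_space[OF M_rv, of \<omega>] by (simp add: Pstar_def)

lemma M_eq_event: "{\<omega> \<in> space P. M \<omega> = m} \<in> events"
proof -
  have "{\<omega> \<in> space P. M \<omega> = m} = M -` ({m} \<inter> Pstar UNIV) \<inter> space P"
    using measurable_space[OF M_rv] by auto
  then show ?thesis
    by (simp only:) (rule measurable_sets[OF M_rv], simp)
qed

lemma R_subset: "n \<ge> 1 \<Longrightarrow> \<omega> \<in> space P \<Longrightarrow> R n \<omega> \<subseteq> {1..n}"
  using measurable_space[OF R_rv, of n \<omega>] by (simp add: Pstar_def)

lemma masked_nth_eq_0_iff: "\<omega> \<in> space P \<Longrightarrow> masked A (X \<omega>) $ j = 0 \<longleftrightarrow> j \<notin> A"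
  using X_range[of \<omega> j] by (simp add: masked_def)

lemma Ms_rv: "i \<ge> 1 \<Longrightarrow> n \<ge> 1 \<Longrightarrow> Ms i n \<in> P \<rightarrow>\<^sub>M mask_space"
  using Ms_process by (auto simp: mask_process_def)

lemma measurable_database:
  "(\<lambda>\<omega>. (\<lambda>i\<in>{1..}. (Xs i \<omega>, Ys i \<omega>), all_masks Ms \<omega>, \<lambda>n\<in>{1..}. R n \<omega>)) \<in>
     database \<rightarrow>\<^sub>M PiM {1..} (\<lambda>_. borel) \<Otimes>\<^sub>M all_masks_space \<Otimes>\<^sub>M
       PiM {1..} (\<lambda>n. count_space (Pstar {1..n}))"
proof -
  \<comment> \<open>Measurability on \<open>P\<close> supplies the range condition: the values lie
    in the space of the product, as \<open>measurable_vimage_algebra1\<close> demands.\<close>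
  have "(\<lambda>\<omega>. (\<lambda>i\<in>{1..}. (Xs i \<omega>, Ys i \<omega>), all_masks Ms \<omega>, \<lambda>n\<in>{1..}. R n \<omega>)) \<in>
     P \<rightarrow>\<^sub>M PiM {1..} (\<lambda>_. borel) \<Otimes>\<^sub>M all_masks_space \<Otimes>\<^sub>M
       PiM {1..} (\<lambda>n. count_space (Pstar {1..n}))"
    unfolding all_masks_def
    by (intro measurable_Pair measurable_restrict borel_measurable_Pair Xs_rv Ys_rv R_rv Ms_rv) auto
  then show ?thesis
    unfolding database_def
    by (intro measurable_vimage_algebra1) (auto dest: measurable_space simp del: PiE_iff)
qed

lemma ratings_database:
  assumes "i \<ge> 1"
  shows "(\<lambda>\<omega>. (Xs i \<omega>, Ys i \<omega>)) \<in> borel_measurable database"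
proof -
  have "(\<lambda>d. fst d i) \<in> PiM {1..} (\<lambda>_. borel) \<Otimes>\<^sub>M all_masks_space \<Otimes>\<^sub>M
       PiM {1..} (\<lambda>n. count_space (Pstar {1..n})) \<rightarrow>\<^sub>M (borel :: ((real ^ 'd) \<times> real) measure)"
    using assms by (intro measurable_compose[OF measurable_fst measurable_component_singleton]) simp
  from measurable_compose[OF measurable_database this] show ?thesis
    using assms by simp
qed

lemma Xs_database: "i \<ge> 1 \<Longrightarrow> Xs i \<in> borel_measurable database"
  using measurable_compose[OF ratings_database
      borel_measurable_continuous_onI[OF continuous_on_fst[OF continuous_on_id]]]
  by simp

lemma Ys_database: "i \<ge> 1 \<Longrightarrow> Ys i \<in> borel_measurable database"
  using measurable_compose[OF ratings_database
      borel_measurable_continuous_onI[OF continuous_on_snd[OF continuous_on_id]]]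
  by simp

lemma Ms_database:
  assumes "i \<ge> 1" "n \<ge> 1"
  shows "Ms i n \<in> database \<rightarrow>\<^sub>M mask_space"
proof -
  have "(\<lambda>d. fst (snd d) i) \<in> PiM {1..} (\<lambda>_. borel) \<Otimes>\<^sub>M all_masks_space \<Otimes>\<^sub>M
       PiM {1..} (\<lambda>n. count_space (Pstar {1..n})) \<rightarrow>\<^sub>M mask_seq_space"
    using assms
    by (intro measurable_compose[OF measurable_snd measurable_compose[OF measurable_fst
          measurable_component_singleton]]) auto
  from measurable_compose[OF measurable_compose[OF measurable_database this]
      measurable_component_singleton[of n]]
  show ?thesis
    using assms by (simp add: all_masks_def)
qed

lemma R_database:
  assumes "n \<ge> 1"
  shows "R n \<in> database \<rightarrow>\<^sub>M count_space (Pstar {1..n})"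
proof -
  have "(\<lambda>d. snd (snd d) n) \<in> PiM {1..} (\<lambda>_. borel) \<Otimes>\<^sub>M all_masks_space \<Otimes>\<^sub>M
       PiM {1..} (\<lambda>n. count_space (Pstar {1..n})) \<rightarrow>\<^sub>M count_space (Pstar {1..n})"
    using assms
    by (intro measurable_compose[OF measurable_snd measurable_compose[OF measurable_snd
          measurable_component_singleton]]) auto
  from measurable_compose[OF measurable_database this] show ?thesis
    using assms by simp
qed

text \<open>Joint measurability in query point and database state is what Fubini requires. The mask
  is a constant \<open>m\<close> because \<open>M\<close> is not among the maps generating
  \<open>database\<close>. The map \<open>f\<close> will be normalization to unit length or the
  identity.\<close>

lemma measurable_knn_estimate_pair:
  fixes f :: "real ^ 'd \<Rightarrow> real ^ 'd"
  assumes n: "n \<ge> 1" and f: "f \<in> borel_measurable borel"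
  shows "(\<lambda>z. knn_estimate (\<lambda>_. m) Xs Ys Ms R k n (f (fst z)) (snd z))
    \<in> borel_measurable (borel \<Otimes>\<^sub>M database)"
proof -
  note snd = measurable_compose[OF measurable_snd]
  have "(\<lambda>z. knn_estimate (\<lambda>_. m) (\<lambda>i z. Xs i (snd z)) (\<lambda>i z. Ys i (snd z))
      (\<lambda>i n z. Ms i n (snd z)) (\<lambda>n z. R n (snd z)) k n (f (fst z)) z)
    \<in> borel_measurable (borel \<Otimes>\<^sub>M database)"
  proof (rule measurable_knn_estimate)
    show "(\<lambda>z. f (fst z)) \<in> borel_measurable (borel \<Otimes>\<^sub>M database)"
      by (rule measurable_compose[OF measurable_fst f])
    show "Measurable.pred (borel \<Otimes>\<^sub>M database) (\<lambda>z. j \<in> Ms i (n + 1 - i) (snd z))"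
      if "i \<in> {1..n}" for i j
      using that by (intro snd[OF measurable_compose[OF Ms_database]]) auto
    show "Measurable.pred (borel \<Otimes>\<^sub>M database) (\<lambda>z. l \<in> R n (snd z))" for l
      using n by (intro snd[OF measurable_compose[OF R_database]]) auto
    show "R n (snd z) \<subseteq> {1..n}" if "z \<in> space (borel \<Otimes>\<^sub>M database)" for z
      using that by (intro R_subset[OF n]) (auto simp: space_pair_measure)
  qed (auto intro!: snd Xs_database Ys_database)
  then show ?thesis
    by (simp only: knn_estimate_reindex[of "\<lambda>_. m"])
qed

lemma measurable_masked_M: "random_variable borel (\<lambda>\<omega>. masked (M \<omega>) (X \<omega>))"
  by (rule measurable_compose_countable'[where f = "\<lambda>A \<omega>. masked A (X \<omega>)", OF _ M_rv])
    (auto intro: measurable_compose[OF X_rv borel_measurable_masked] countable_finite)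

lemma measurable_knn_estimate_P:
  assumes n: "n \<ge> 1"
  shows "random_variable borel (\<lambda>\<omega>. knn_estimate M Xs Ys Ms R k n (masked (M \<omega>) (X \<omega>)) \<omega>)"
proof (rule measurable_knn_estimate)
  show "Measurable.pred P (\<lambda>\<omega>. j \<in> Ms i (n + 1 - i) \<omega>)" if "i \<in> {1..n}" for i j
    using that by (intro measurable_compose[OF Ms_rv]) auto
  show "Measurable.pred P (\<lambda>\<omega>. l \<in> R n \<omega>)" for l
    using n by (intro measurable_compose[OF R_rv]) auto
qed (use n R_subset in \<open>auto intro!: measurable_masked_M M_pred Xs_rv Ys_rv\<close>)

section \<open>Freezing the database for each mask\<close>

text \<open>Conditioning on \<open>M \<omega> = m\<close> turns \<open>new_user\<close> into plain
  independence of the masked ratings and the database, so the database argument can be frozen.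
  Writing the limit with the total function \<open>lim\<close> makes the property an equation
  between measurable functions.\<close>

lemma frozen_database:
  assumes pos: "prob {\<omega> \<in> space P. M \<omega> = m} > 0"
    and r: "\<And>n. r n \<ge> 1" and f: "f \<in> borel_measurable borel" and h: "h \<in> borel_measurable borel"
    and conv: "AE \<omega> in P. (\<lambda>n. knn_estimate M Xs Ys Ms R k (r n) (f (masked (M \<omega>) (X \<omega>))) \<omega>)
      \<longlonglongrightarrow> h (masked (M \<omega>) (X \<omega>))"
  shows "\<exists>\<omega>'\<in>space P. AE \<omega> in P. M \<omega> = m \<longrightarrow> h (masked m (X \<omega>)) =
    lim (\<lambda>n. knn_estimate (\<lambda>_. m) Xs Ys Ms R k (r n) (f (masked m (X \<omega>))) \<omega>')"
proof -
  define B where "B = {\<omega> \<in> space P. M \<omega> = m}"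
  define Q where "Q = uniform_measure P B"
  have B: "B \<in> events"
    unfolding B_def by (rule M_eq_event)
  have eB: "emeasure P B \<noteq> 0"
    using pos by (auto simp: B_def[symmetric] emeasure_eq_measure)
  \<comment> \<open>This translates almost sure statements between the conditioned measure
    \<open>Q\<close> and \<open>P\<close>, in both directions below.\<close>
  have AE_Q: "(AE \<omega> in Q. F \<omega>) \<longleftrightarrow> (AE \<omega> in P. M \<omega> = m \<longrightarrow> F \<omega>)" for F
  proof -
    have "(AE \<omega> in Q. F \<omega>) \<longleftrightarrow> (AE \<omega> in P. \<omega> \<in> B \<longrightarrow> F \<omega>)"
      unfolding Q_def using eB by (intro AE_uniform_measure) (auto simp: emeasure_eq_measure)
    also have "\<dots> \<longleftrightarrow> (AE \<omega> in P. M \<omega> = m \<longrightarrow> F \<omega>)"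
      by (intro AE_cong) (auto simp: B_def)
    finally show ?thesis .
  qed
  interpret Q: prob_space Q
    unfolding Q_def using eB by (intro prob_space_uniform_measure) (auto simp: emeasure_eq_measure)
  have space_Q [simp]: "space Q = space P" and sets_Q [measurable_cong]: "sets Q = sets P"
    by (simp_all add: Q_def)
  \<comment> \<open>For fixed \<open>m\<close> the masked vector is a function of the pair of
    ratings. Since \<open>gen_sets\<close> looks only at the space of its measure, \<open>Q\<close>
    and \<open>P\<close> are interchangeable here.\<close>
  have sub: "gen_sets Q borel (\<lambda>\<omega>. masked m (X \<omega>)) \<subseteq> gen_sets P borel (\<lambda>\<omega>. (X \<omega>, Y \<omega>))"
  proof -
    have "(\<lambda>z. masked m (fst z)) \<in> (borel :: ((real ^ 'd) \<times> real) measure) \<rightarrow>\<^sub>M borel"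
      by (rule measurable_compose[OF _ borel_measurable_masked])
        (intro borel_measurable_continuous_onI continuous_intros)
    from gen_sets_compose_subset[OF this, of "\<lambda>\<omega>. (X \<omega>, Y \<omega>)" P] show ?thesis
      by (simp add: gen_sets_def)
  qed
  have "Q.indep_set (gen_sets P borel (\<lambda>\<omega>. (X \<omega>, Y \<omega>))) (sets database)"
    using new_user[OF pos] by (simp add: Q_def B_def sets_database)
  then have "Q.indep_set (gen_sets Q borel (\<lambda>\<omega>. masked m (X \<omega>))) (sets database)"
    unfolding Q.indep_set_def
    by (rule Q.indep_sets_mono_sets) (use sub in \<open>auto split: bool.split\<close>)
  moreover have "Measurable.pred (borel \<Otimes>\<^sub>M database)
      (\<lambda>z. h (fst z) = lim (\<lambda>n. knn_estimate (\<lambda>_. m) Xs Ys Ms R k (r n) (f (fst z)) (snd z)))"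
  proof -
    have [measurable]: "(\<lambda>z. lim (\<lambda>n. knn_estimate (\<lambda>_. m) Xs Ys Ms R k (r n) (f (fst z)) (snd z)))
        \<in> borel_measurable (borel \<Otimes>\<^sub>M database)"
      by (intro borel_measurable_lim_metric measurable_knn_estimate_pair r f)
    note h [measurable]
    show ?thesis by measurable
  qed
  moreover have "AE \<omega> in Q. h (masked m (X \<omega>)) =
      lim (\<lambda>n. knn_estimate (\<lambda>_. m) Xs Ys Ms R k (r n) (f (masked m (X \<omega>))) \<omega>)"
    unfolding AE_Q using conv
    by eventually_elim (auto simp: knn_estimate_mask_cong[of M _ "\<lambda>_. m"] dest: limI)
  moreover have "(\<lambda>\<omega>. masked m (X \<omega>)) \<in> borel_measurable Q"
    using measurable_compose[OF X_rv borel_measurable_masked] by (simp add: Q_def)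
  ultimately show ?thesis
    using Q.indep_set_imp_frozen_AE[of borel "\<lambda>\<omega>. masked m (X \<omega>)" database
        "\<lambda>z. h (fst z) = lim (\<lambda>n. knn_estimate (\<lambda>_. m) Xs Ys Ms R k (r n) (f (fst z)) (snd z))"]
    by (simp add: AE_Q)
qed

text \<open>Each mask \<open>m\<close> receives a frozen database state \<open>d m\<close>. The
  function \<open>g\<close> recovers the mask as the support of its argument and takes the limit of
  the estimates in that frozen state.\<close>

lemma regression_fun_of_direction:
  assumes \<eta> [measurable]: "\<eta> \<in> borel_measurable borel"
    and conv: "tendsto_in_prob P
      (\<lambda>n \<omega>. knn_estimate M Xs Ys Ms R k n (masked (M \<omega>) (X \<omega>)) \<omega>) (\<lambda>\<omega>. \<eta> (masked (M \<omega>) (X \<omega>)))"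
  shows "\<exists>g \<in> borel_measurable borel. AE \<omega> in P.
    \<eta> (masked (M \<omega>) (X \<omega>)) / norm (masked (M \<omega>) (X \<omega>)) =
      g (masked (M \<omega>) (X \<omega>) /\<^sub>R norm (masked (M \<omega>) (X \<omega>)))"
proof -
  let ?V = "\<lambda>\<omega>. masked (M \<omega>) (X \<omega>)"
  define f where "f x = x /\<^sub>R norm x" for x :: "real ^ 'd"
  define h where "h x = \<eta> x / norm x" for x
  have f [measurable]: "f \<in> borel_measurable borel" and h: "h \<in> borel_measurable borel"
    unfolding f_def h_def by measurable
  have nz: "?V \<omega> \<noteq> 0" if "\<omega> \<in> space P" for \<omega>
    using M_nonempty[OF that] masked_nth_eq_0_iff[OF that] by (auto simp: vec_eq_iff)
  \<comment> \<open>Ratings are at least 1, so the visible coordinates are exactly the nonzero ones,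
    and normalization preserves them.\<close>
  have supp: "{j. f (masked A (X \<omega>)) $ j \<noteq> 0} = A" if "\<omega> \<in> space P" for A \<omega>
  proof -
    have "f x $ j = 0 \<longleftrightarrow> x $ j = 0" for x j
      by (auto simp: f_def)
    then show ?thesis
      using masked_nth_eq_0_iff[OF that, of A] by simp
  qed
  \<comment> \<open>Times start at 1, where measurability of the estimate begins; the shift by
    \<open>Suc\<close> avoids index 0.\<close>
  let ?Z = "\<lambda>n \<omega>. knn_estimate M Xs Ys Ms R k (Suc n) (?V \<omega>) \<omega>"
  have "tendsto_in_prob P ?Z (\<lambda>\<omega>. \<eta> (?V \<omega>))"
    unfolding tendsto_in_prob_def
  proof (intro allI impI)
    fix \<epsilon> :: real assume "\<epsilon> > 0"
    with conv have "(\<lambda>n. prob {\<omega> \<in> space P.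
        \<bar>knn_estimate M Xs Ys Ms R k n (?V \<omega>) \<omega> - \<eta> (?V \<omega>)\<bar> > \<epsilon>}) \<longlonglongrightarrow> 0"
      unfolding tendsto_in_prob_def by blast
    from LIMSEQ_Suc[OF this]
    show "(\<lambda>n. prob {\<omega> \<in> space P. \<bar>?Z n \<omega> - \<eta> (?V \<omega>)\<bar> > \<epsilon>}) \<longlonglongrightarrow> 0" .
  qed
  then have "\<exists>r. AE \<omega> in P. (\<lambda>n. ?Z (r n) \<omega>) \<longlonglongrightarrow> \<eta> (?V \<omega>)"
    by (rule tendsto_in_prob_imp_AE_subseq)
      (auto intro: measurable_knn_estimate_P measurable_compose[OF measurable_masked_M \<eta>])
  then obtain r where "AE \<omega> in P. (\<lambda>n. ?Z (r n) \<omega>) \<longlonglongrightarrow> \<eta> (?V \<omega>)" ..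
  with AE_space have r:
    "AE \<omega> in P. (\<lambda>n. knn_estimate M Xs Ys Ms R k (Suc (r n)) (f (?V \<omega>)) \<omega>) \<longlonglongrightarrow> h (?V \<omega>)"
  proof eventually_elim
    case (elim \<omega>)
    then have "norm (?V \<omega>) > 0" using nz by simp
    moreover from this have "(\<lambda>n. ?Z (r n) \<omega> / norm (?V \<omega>)) \<longlonglongrightarrow> h (?V \<omega>)"
      unfolding h_def using elim by (intro tendsto_divide tendsto_const) auto
    ultimately show ?case
      by (simp add: f_def knn_estimate_scaleR divide_inverse mult.commute)
  qed
  define good where "good m \<omega>' \<longleftrightarrow> (AE \<omega> in P. M \<omega> = m \<longrightarrow> h (masked m (X \<omega>)) =
      lim (\<lambda>n. knn_estimate (\<lambda>_. m) Xs Ys Ms R k (Suc (r n)) (f (masked m (X \<omega>))) \<omega>'))"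
    for m \<omega>'
  have "\<exists>\<omega>'\<in>space P. good m \<omega>'" for m
  proof (cases "prob {\<omega> \<in> space P. M \<omega> = m} > 0")
    case True
    then show ?thesis
      unfolding good_def using f h r by (intro frozen_database) auto
  next
    \<comment> \<open>A mask of probability zero imposes a vacuous condition, so any state of the
      nonempty sample space will do.\<close>
    case False
    have "{\<omega> \<in> space P. M \<omega> = m} \<in> events"
      by (rule M_eq_event)
    moreover have "prob {\<omega> \<in> space P. M \<omega> = m} = 0"
      using False by (simp add: zero_less_measure_iff)
    ultimately have "AE \<omega> in P. M \<omega> \<noteq> m"
      by (subst (asm) prob_eq_0) auto
    then have "good m \<omega>'" for \<omega>'
      unfolding good_def by eventually_elim simp
    with not_empty show ?thesis by blast
  qed
  then obtain d where d: "\<And>m. d m \<in> space P" and lim: "\<And>m. good m (d m)"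
    by metis
  define g where "g u = (let m = {j. u $ j \<noteq> 0} in
      lim (\<lambda>n. knn_estimate (\<lambda>_. m) Xs Ys Ms R k (Suc (r n)) u (d m)))" for u
  have "g \<in> borel_measurable borel"
    \<comment> \<open>The function \<open>g\<close> is glued from finitely many pieces: a section of
      a jointly measurable map for each mask, selected by the measurable support map.\<close>
    unfolding g_def Let_def
  proof (rule measurable_compose_countable[where
        f = "\<lambda>m u. lim (\<lambda>n. knn_estimate (\<lambda>_. m) Xs Ys Ms R k (Suc (r n)) u (d m))"])
    fix m
    have "(\<lambda>u. knn_estimate (\<lambda>_. m) Xs Ys Ms R k (Suc (r n)) u (d m)) \<in> borel_measurable borel" for n
      using measurable_Pair1[OF measurable_knn_estimate_pair[of "Suc (r n)" "\<lambda>x. x" m], of "d m"] d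
      by simp
    then show "(\<lambda>u. lim (\<lambda>n. knn_estimate (\<lambda>_. m) Xs Ys Ms R k (Suc (r n)) u (d m)))
        \<in> borel_measurable borel"
      by (rule borel_measurable_lim_metric)
  next
    have "(\<lambda>u :: real ^ 'd. {j. u $ j \<noteq> 0}) -` {A} \<in> sets borel" for A
    proof -
      have [measurable]: "(\<lambda>u :: real ^ 'd. u $ j) \<in> borel_measurable borel" for j
        by (rule borel_measurable_nth)
      have "(\<lambda>u :: real ^ 'd. {j. u $ j \<noteq> 0}) -` {A} =
          {u \<in> space borel. \<forall>j. u $ j \<noteq> 0 \<longleftrightarrow> j \<in> A}"
        by auto
      also have "\<dots> \<in> sets borel"
        by measurable
      finally show ?thesis .
    qed
    then show "(\<lambda>u :: real ^ 'd. {j. u $ j \<noteq> 0}) \<in> borel \<rightarrow>\<^sub>M count_space UNIV"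
      by (simp add: measurable_count_space_eq2_countable)
  qed
  \<comment> \<open>There are only finitely many masks, so a single null set works for all of them
    and \<open>m\<close> may then be taken to be \<open>M \<omega>\<close>.\<close>
  moreover have "AE \<omega> in P. \<forall>m. M \<omega> = m \<longrightarrow> h (masked m (X \<omega>)) =
      lim (\<lambda>n. knn_estimate (\<lambda>_. m) Xs Ys Ms R k (Suc (r n)) (f (masked m (X \<omega>))) (d m))"
    by (intro AE_all_countable[THEN iffD2] allI lim[unfolded good_def])
  with AE_space have "AE \<omega> in P. h (?V \<omega>) = g (f (?V \<omega>))"
  proof eventually_elim
    case (elim \<omega>)
    from elim(2)[rule_format, OF refl] show ?case
      unfolding g_def Let_def supp[OF elim(1)] .
  qed
  ultimately show ?thesis
    unfolding h_def f_def by blast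
qed

end

theorem theorem3p1:
  fixes P :: "'a measure" and s :: real
    and X :: "'a \<Rightarrow> real ^ 'd::finite" and Y :: "'a \<Rightarrow> real" and M :: "'a \<Rightarrow> 'd set"
    and Xs :: "nat \<Rightarrow> 'a \<Rightarrow> real ^ 'd" and Ys :: "nat \<Rightarrow> 'a \<Rightarrow> real"
    and Ms :: "nat \<Rightarrow> nat \<Rightarrow> 'a \<Rightarrow> 'd set"
    and G :: "nat \<Rightarrow> 'a \<Rightarrow> 'd set" and n0 :: "'a \<Rightarrow> nat"
    and R :: "nat \<Rightarrow> 'a \<Rightarrow> nat set" and k :: "nat \<Rightarrow> nat"
    and Xstar :: "'a \<Rightarrow> real ^ 'd" and \<eta> :: "real ^ 'd \<Rightarrow> real"
  assumes "recommendation_model P s X Y M Xs Ys Ms G n0 R k"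
    and "Xstar = (\<lambda>\<omega>. masked (M \<omega>) (X \<omega>))"
    and "is_regression_fun P Y Xstar \<eta>"
    and "tendsto_in_prob P (\<lambda>n \<omega>. knn_estimate M Xs Ys Ms R k n (Xstar \<omega>) \<omega>) (\<lambda>\<omega>. \<eta> (Xstar \<omega>))"
  shows "AE \<omega> in P. \<eta> (Xstar \<omega>) =
           norm (Xstar \<omega>) *
           cond_exp_given P (\<lambda>\<omega>. Y \<omega> / norm (Xstar \<omega>)) (\<lambda>\<omega>. Xstar \<omega> /\<^sub>R norm (Xstar \<omega>)) \<omega>"
proof -
  interpret recommendation_model P s X Y M Xs Ys Ms G n0 R k
    by (rule assms(1))
  note Y_rv [measurable]
  have V [measurable]: "random_variable borel Xstar"
    unfolding assms(2) by (rule measurable_masked_M)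
  \<comment> \<open>A visible rating is at least 1. The bound makes \<open>Xstar\<close> nonzero and
    keeps \<open>Y \<omega> / norm (Xstar \<omega>)\<close> below \<open>s\<close>, hence
    integrable.\<close>
  have norm_ge: "norm (Xstar \<omega>) \<ge> 1" if \<omega>: "\<omega> \<in> space P" for \<omega>
  proof -
    obtain j where "j \<in> M \<omega>"
      using M_nonempty[OF \<omega>] by blast
    then have "1 \<le> \<bar>Xstar \<omega> $ j\<bar>"
      using X_range[OF \<omega>, of j] by (simp add: assms(2) masked_def)
    also have "\<dots> \<le> norm (Xstar \<omega>)"
      by (rule component_le_norm_cart)
    finally show ?thesis .
  qed
  have "integrable P (\<lambda>\<omega>. Y \<omega> / norm (Xstar \<omega>))"
  proof (rule integrable_const_bound[where B = s])
    show "AE \<omega> in P. norm (Y \<omega> / norm (Xstar \<omega>)) \<le> s"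
      using AE_space
    proof eventually_elim
      case (elim \<omega>)
      have "Y \<omega> / norm (Xstar \<omega>) \<le> s / 1"
        using norm_ge[OF elim] Y_range[OF elim] by (intro frac_le) auto
      then show ?case
        using Y_range[OF elim] by simp
    qed
  qed measurable
  moreover have "\<eta> \<in> borel_measurable borel"
    using assms(3) by (simp add: is_regression_fun_def)
  then obtain g where "g \<in> borel_measurable borel"
    and "AE \<omega> in P. \<eta> (Xstar \<omega>) / norm (Xstar \<omega>) = g (Xstar \<omega> /\<^sub>R norm (Xstar \<omega>))"
    using regression_fun_of_direction[of \<eta>] assms(2,4) by auto
  moreover have "Xstar \<omega> \<noteq> 0" if "\<omega> \<in> space P" for \<omega>
    using norm_ge[OF that] by auto
  ultimately show ?thesis
    using V Y_rv assms(3) by (intro regression_direction)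
qed

end
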